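(* Let $\alpha\in(0,1]$, let $N_1,N_2,\beta_1,\beta_2,\varepsilon$ be positive constants, and set $$\theta:=\varepsilon\Big(\frac{N_1}{\beta_1}+\frac{N_2}{\beta_2}\Big),\qquad K_i:=\frac{N_i}{1-\theta},\qquad \lambda_i:=\beta_i-\frac{\varepsilon N_i}{1-\theta},\quad i=1,2.$$ Assume $\theta<1$. (i) If $s\ge t_0\ge0$ and $u:[t_0,s]\to[0,\infty)$ is bounded, continuous and satisfies, for all $t\in[t_0,s]$, $$u(t)\le N_2\frac{E_\alpha(\beta_2,t)}{E_\alpha(\beta_2,s)}+\frac{\varepsilon N_1}{E_\alpha(\beta_1,t)}\int_{t_0}^t|\tau|^{\alpha-1}E_\alpha(\beta_1,\tau)u(\tau)\,d\tau+\varepsilon N_2E_\alpha(\beta_2,t)\int_t^s|\tau|^{\alpha-1}\frac{u(\tau)}{E_\alpha(\beta_2,\tau)}\,d\tau,$$ then $u(t)\le K_2\dfrac{E_\alpha(\lambda_2,t)}{E_\alpha(\lambda_2,s)}$ for $s\ge t\ge t_0$. (ii) If $s\le t_0\le0$ and $u:[s,t_0]\to[0,\infty)$ is bounded, continuous and satisfies, for all $t\in[s,t_0]$, $$u(t)\le N_1\frac{E_\alpha(\beta_1,s)}{E_\alpha(\beta_1,t)}+\varepsilon N_2E_\alpha(\beta_2,t)\int_t^{t_0}|\tau|^{\alpha-1}\frac{u(\tau)}{E_\alpha(\beta_2,\tau)}\,d\tau+\frac{\varepsilon N_1}{E_\alpha(\beta_1,t)}\int_s^t|\tau|^{\alpha-1}E_\alpha(\beta_1,\tau)u(\tau)\,d\tau,$$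 then $u(t)\le K_1\dfrac{E_\alpha(\lambda_1,s)}{E_\alpha(\lambda_1,t)}$ for $s\le t\le t_0$.
   Context: $E_\alpha(\lambda,t):=\exp(\lambda t^\alpha/\alpha)$ for $t\ge0$ and $E_\alpha(\lambda,t):=\exp(-\lambda(-t)^\alpha/\alpha)$ for $t\le0$, for $\lambda\in\mathbb{R}$. *)

theory Defs
  imports "HOL-Analysis.Analysis"
begin

definition E :: "real \<Rightarrow> real \<Rightarrow> real \<Rightarrow> real" where
  "E \<alpha> l t = (if 0 \<le> t then exp (l * t powr \<alpha> / \<alpha>) else exp (- l * (- t) powr \<alpha> / \<alpha>))"

text \<open>The two branches agree at zero, so the formula for negative times holds on the
  closed half-line as well.\<close>

lemma E_nonpos: "t \<le> 0 \<Longrightarrow> E \<alpha> l t = exp (- l * (- t) powr \<alpha> / \<alpha>)"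
  by (auto simp: E_def)

end

theory Submission
  imports Defs
begin

text \<open>The substitution \<open>x = t powr \<alpha> / \<alpha>\<close> turns the weights into ordinary exponentials. The right-hand
  side of the integral inequality is a forcing term plus a positive integral operator of
  supremum norm at most \<open>\<theta> < 1\<close>, so a maximum principle makes every supersolution an upper
  bound for \<open>u\<close>. If \<open>lam2\<close> is nonnegative, the claimed bound is itself a supersolution; if it is
  negative, the constant \<open>K2\<close> is a supersolution lying below the claimed bound. Negative times
  follow by the reflection \<open>t \<mapsto> - t\<close>, which exchanges the indices 1 and 2.\<close>

lemma E_nonneg: "0 \<le> t \<Longrightarrow> E \<alpha> l t = exp (l * (t powr \<alpha> / \<alpha>))"
  by (simp add: E_def)

text \<open>The exponent is an odd function of \<open>t\<close>. Under reflection this turns the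
  multiplicative kernel weight into the reciprocal one, and conversely.\<close>

lemma E_minus: "E \<alpha> l (- t) = 1 / E \<alpha> l t"
  by (auto simp: E_def exp_minus divide_inverse)

lemma E_pos: "0 < E \<alpha> l t"
  by (simp add: E_def)

lemma E_add: "E \<alpha> (k + l) t = E \<alpha> k t * E \<alpha> l t"
  by (auto simp: E_def exp_add [symmetric] add_divide_distrib diff_divide_distrib algebra_simps)

lemma E_uminus: "E \<alpha> (- l) t = 1 / E \<alpha> l t"
  by (auto simp: E_def exp_minus divide_inverse)

lemma E_mono:
  assumes "0 < \<alpha>" "0 \<le> l" "0 \<le> a" "a \<le> b"
  shows "E \<alpha> l a \<le> E \<alpha> l b"
  using assms by (auto simp: E_def intro!: divide_right_mono mult_left_mono powr_mono2)

lemma continuous_on_E: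
  assumes "0 < \<alpha>" "S \<subseteq> {0..}"
  shows "continuous_on S (E \<alpha> l)"
proof -
  have "continuous_on S (\<lambda>t. exp (l * (t powr \<alpha> / \<alpha>)))"
    using assms by (intro continuous_intros continuous_on_powr') auto
  then show ?thesis
    using assms by (subst continuous_on_cong [OF refl E_nonneg]) auto
qed

text \<open>Away from zero the derivative of \<open>t powr \<alpha> / \<alpha>\<close> is the
  weight, so \<open>E \<alpha> k t / k\<close> is an antiderivative. Either sign of \<open>k\<close>
  is allowed, since both \<open>\<beta>1\<close> and \<open>- \<beta>2\<close> occur as
  rates.\<close>

lemma has_integral_weight_E:
  fixes \<alpha> k a b :: real
  assumes "0 < \<alpha>" "k \<noteq> 0" "0 \<le> a" "a \<le> b"
  shows "((\<lambda>t. \<bar>t\<bar> powr (\<alpha> - 1) * E \<alpha> k t) has_integral (E \<alpha> k b - E \<alpha> k a) / k) {a..b}"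
proof -
  have "((\<lambda>t. \<bar>t\<bar> powr (\<alpha> - 1) * E \<alpha> k t) has_integral (E \<alpha> k b / k - E \<alpha> k a / k)) {a..b}"
  \<comment> \<open>For \<open>\<alpha> < 1\<close> the weight is unbounded near 0, so if
    \<open>a = 0\<close> the antiderivative is only continuous at that endpoint. The interior
    version asks for no more.\<close>
  proof (rule fundamental_theorem_of_calculus_interior)
    show "continuous_on {a..b} (\<lambda>t. E \<alpha> k t / k)"
      using assms by (intro continuous_intros continuous_on_E) auto
    fix t assume t: "t \<in> {a<..<b}"
    then have "0 < t" using assms by auto
    have "((\<lambda>t. exp (k * (t powr \<alpha> / \<alpha>)) / k) has_real_derivative
        \<bar>t\<bar> powr (\<alpha> - 1) * exp (k * (t powr \<alpha> / \<alpha>))) (at t)"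
      using \<open>0 < t\<close> assms by (auto intro!: derivative_eq_intros)
    then have "((\<lambda>t. E \<alpha> k t / k) has_real_derivative \<bar>t\<bar> powr (\<alpha> - 1) * exp (k * (t powr \<alpha> / \<alpha>))) (at t)"
      by (rule has_field_derivative_transform_within_open [where S = "{0<..}"])
        (use \<open>0 < t\<close> in \<open>auto simp: E_nonneg\<close>)
    then show "((\<lambda>t. E \<alpha> k t / k) has_vector_derivative \<bar>t\<bar> powr (\<alpha> - 1) * E \<alpha> k t) (at t)"
      using \<open>0 < t\<close> by (simp add: has_real_derivative_iff_has_vector_derivative E_nonneg)
  qed (use assms in auto)
  then show ?thesis by (simp add: diff_divide_distrib)
qed

text \<open>The product may be unbounded near 0, so continuity does not settle integrability. The
  kernel is nonnegative, hence absolutely integrable, and multiplication by a bounded measurable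
  function preserves this.\<close>

lemma weight_E_times_continuous_integrable:
  fixes \<alpha> k a b :: real
  assumes "0 < \<alpha>" "k \<noteq> 0" "0 \<le> a" "a \<le> b" "continuous_on {a..b} u"
  shows "(\<lambda>t. \<bar>t\<bar> powr (\<alpha> - 1) * E \<alpha> k t * u t) integrable_on {a..b}"
proof -
  have "(\<lambda>t. \<bar>t\<bar> powr (\<alpha> - 1) * E \<alpha> k t) absolutely_integrable_on {a..b}"
    using has_integral_weight_E [OF assms(1-4)]
    by (intro nonnegative_absolutely_integrable_1) (auto simp: less_imp_le [OF E_pos])
  moreover have "bounded (u ` {a..b})"
    using assms(5) compact_Icc compact_continuous_image compact_imp_bounded by blast
  moreover have "u \<in> borel_measurable (lebesgue_on {a..b})"
    using assms(5) by (intro continuous_imp_measurable_on_sets_lebesgue) auto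
  ultimately have "(\<lambda>t. u t * (\<bar>t\<bar> powr (\<alpha> - 1) * E \<alpha> k t)) absolutely_integrable_on {a..b}"
    by (intro absolutely_integrable_bounded_measurable_product_real [where f = u]) auto
  then have "(\<lambda>t. u t * (\<bar>t\<bar> powr (\<alpha> - 1) * E \<alpha> k t)) integrable_on {a..b}"
    by (rule set_lebesgue_integral_eq_integral(1))
  then show ?thesis by (simp add: mult_ac)
qed

text \<open>The majorant is a trial supersolution plus a constant excess. Against the kernel it
  integrates in closed form, because multiplying exponentials adds their rates.\<close>

lemma integral_weight_E_le:
  fixes \<alpha> k \<mu> C M a b :: real
  assumes "0 < \<alpha>" "k \<noteq> 0" "k + \<mu> \<noteq> 0" "0 \<le> a" "a \<le> b" "continuous_on {a..b} u"
    and u: "\<And>t. t \<in> {a..b} \<Longrightarrow> u t \<le> C * E \<alpha> \<mu> t + M"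
  shows "integral {a..b} (\<lambda>t. \<bar>t\<bar> powr (\<alpha> - 1) * E \<alpha> k t * u t)
    \<le> C * ((E \<alpha> (k + \<mu>) b - E \<alpha> (k + \<mu>) a) / (k + \<mu>)) + M * ((E \<alpha> k b - E \<alpha> k a) / k)"
proof -
  have *: "((\<lambda>t. C * (\<bar>t\<bar> powr (\<alpha> - 1) * E \<alpha> (k + \<mu>) t) + M * (\<bar>t\<bar> powr (\<alpha> - 1) * E \<alpha> k t)) has_integral
     (C * ((E \<alpha> (k + \<mu>) b - E \<alpha> (k + \<mu>) a) / (k + \<mu>)) + M * ((E \<alpha> k b - E \<alpha> k a) / k))) {a..b}"
    using assms by (intro has_integral_add has_integral_mult_right has_integral_weight_E) auto
  show ?thesis
  proof (rule has_integral_le [OF integrable_integral *])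
    show "(\<lambda>t. \<bar>t\<bar> powr (\<alpha> - 1) * E \<alpha> k t * u t) integrable_on {a..b}"
      using assms by (intro weight_E_times_continuous_integrable)
    fix t assume t: "t \<in> {a..b}"
    have "\<bar>t\<bar> powr (\<alpha> - 1) * E \<alpha> k t * u t \<le> \<bar>t\<bar> powr (\<alpha> - 1) * E \<alpha> k t * (C * E \<alpha> \<mu> t + M)"
      using u [OF t] by (intro mult_left_mono) (auto simp: less_imp_le [OF E_pos])
    then show "\<bar>t\<bar> powr (\<alpha> - 1) * E \<alpha> k t * u t
      \<le> C * (\<bar>t\<bar> powr (\<alpha> - 1) * E \<alpha> (k + \<mu>) t) + M * (\<bar>t\<bar> powr (\<alpha> - 1) * E \<alpha> k t)"
      by (simp add: E_add algebra_simps)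
  qed
qed

text \<open>Suppose \<open>u\<close> exceeds the bound somewhere, and let \<open>M > 0\<close> be
  the largest excess. Inserting bound plus \<open>M\<close> into the right-hand side gives back at
  most the bound plus \<open>\<theta> * M\<close>, too little at a point where the excess is
  \<open>M\<close>. The rate \<open>\<mu>\<close> is left general to cover both a growing and a
  constant supersolution.\<close>

lemma le_supersolution:
  fixes \<alpha> \<epsilon> N1 N2 \<beta>1 \<beta>2 \<theta> \<mu> t0 s :: real
  assumes pos: "0 < \<alpha>" "0 < N1" "0 < N2" "0 < \<beta>1" "0 < \<beta>2" "0 < \<epsilon>"
    and \<theta>: "\<theta> = \<epsilon> * (N1 / \<beta>1 + N2 / \<beta>2)" "\<theta> < 1"
    and \<mu>: "0 \<le> \<mu>" "\<mu> < \<beta>2" "\<epsilon> * N1 / (\<beta>1 + \<mu>) + \<epsilon> * N2 / (\<beta>2 - \<mu>) \<le> 1"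
    and t0: "0 \<le> t0" "t0 \<le> s"
    and cont: "continuous_on {t0..s} u"
    and u: "\<And>t. t \<in> {t0..s} \<Longrightarrow> u t \<le> N2 * (E \<alpha> \<beta>2 t / E \<alpha> \<beta>2 s)
             + \<epsilon> * N1 / E \<alpha> \<beta>1 t
                 * integral {t0..t} (\<lambda>\<tau>. \<bar>\<tau>\<bar> powr (\<alpha> - 1) * E \<alpha> \<beta>1 \<tau> * u \<tau>)
             + \<epsilon> * N2 * E \<alpha> \<beta>2 t
                 * integral {t..s} (\<lambda>\<tau>. \<bar>\<tau>\<bar> powr (\<alpha> - 1) * (u \<tau> / E \<alpha> \<beta>2 \<tau>))"
    and t: "t \<in> {t0..s}"
  shows "u t \<le> N2 / (1 - \<theta>) * (E \<alpha> \<mu> t / E \<alpha> \<mu> s)"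
proof (rule ccontr)
  define K where "K = N2 / (1 - \<theta>)"
  define C where "C = K / E \<alpha> \<mu> s"
  have K: "0 < K" "N2 = (1 - \<theta>) * K"
    using pos \<theta> by (auto simp: K_def)
  have C: "0 < C" using K by (simp add: C_def E_pos)
  assume "\<not> ?thesis"
  then have gt: "u t > C * E \<alpha> \<mu> t" by (simp add: C_def K_def)
  have "continuous_on {t0..s} (\<lambda>t. u t - C * E \<alpha> \<mu> t)"
    using pos t0 by (intro continuous_intros cont continuous_on_E) auto
  then obtain r where r: "r \<in> {t0..s}"
      and max: "\<And>y. y \<in> {t0..s} \<Longrightarrow> u y - C * E \<alpha> \<mu> y \<le> u r - C * E \<alpha> \<mu> r"
    using continuous_attains_sup [of "{t0..s}" "\<lambda>t. u t - C * E \<alpha> \<mu> t"] t by auto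
  define M where "M = u r - C * E \<alpha> \<mu> r"
  have M: "0 < M" using max [OF t] gt by (simp add: M_def)
  have le: "u y \<le> C * E \<alpha> \<mu> y + M" if "y \<in> {t0..s}" for y
    using max [OF that] by (simp add: M_def)
  let ?I1 = "integral {t0..r} (\<lambda>\<tau>. \<bar>\<tau>\<bar> powr (\<alpha> - 1) * E \<alpha> \<beta>1 \<tau> * u \<tau>)"
  let ?I2 = "integral {r..s} (\<lambda>\<tau>. \<bar>\<tau>\<bar> powr (\<alpha> - 1) * (u \<tau> / E \<alpha> \<beta>2 \<tau>))"
  have cont': "continuous_on {t0..r} u" "continuous_on {r..s} u"
    using r by (auto intro: continuous_on_subset [OF cont])
  \<comment> \<open>In terms of the supersolution's value \<open>w\<close> at the maximum point and
    the decay factor \<open>e\<close> between \<open>r\<close> and \<open>s\<close>, its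
    contributions and the forcing term are bounded by \<open>w\<close> times expressions affine in
    \<open>e\<close>.\<close>
  define w where "w = C * E \<alpha> \<mu> r"
  define e where "e = E \<alpha> (\<beta>2 - \<mu>) r / E \<alpha> (\<beta>2 - \<mu>) s"
  have w: "0 < w" using C by (simp add: w_def E_pos)
  have e: "0 < e" "e \<le> 1"
    using E_mono [of \<alpha> "\<beta>2 - \<mu>" r s] pos \<mu> r t0 by (auto simp: e_def E_pos)
  have E2: "E \<alpha> \<beta>2 y = E \<alpha> (\<beta>2 - \<mu>) y * E \<alpha> \<mu> y" for y
    by (simp flip: E_add)
  have f: "N2 * (E \<alpha> \<beta>2 r / E \<alpha> \<beta>2 s) = (1 - \<theta>) * w * e"
    by (simp add: K w_def e_def C_def E2 mult_ac)
  have "?I1 \<le> C * ((E \<alpha> (\<beta>1 + \<mu>) r - E \<alpha> (\<beta>1 + \<mu>) t0) / (\<beta>1 + \<mu>))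
      + M * ((E \<alpha> \<beta>1 r - E \<alpha> \<beta>1 t0) / \<beta>1)"
    using pos \<mu> t0 r le cont' by (intro integral_weight_E_le) auto
  also have "\<dots> \<le> C * (E \<alpha> (\<beta>1 + \<mu>) r / (\<beta>1 + \<mu>)) + M * (E \<alpha> \<beta>1 r / \<beta>1)"
    using C M pos \<mu> by (intro add_mono mult_left_mono divide_right_mono)
      (auto simp: less_imp_le [OF E_pos])
  also have "\<dots> = E \<alpha> \<beta>1 r * (w / (\<beta>1 + \<mu>) + M / \<beta>1)"
    by (simp add: w_def E_add algebra_simps)
  finally have "\<epsilon> * N1 / E \<alpha> \<beta>1 r * ?I1
      \<le> \<epsilon> * N1 / E \<alpha> \<beta>1 r * (E \<alpha> \<beta>1 r * (w / (\<beta>1 + \<mu>) + M / \<beta>1))"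
    using pos by (intro mult_left_mono) (auto simp: less_imp_le [OF E_pos])
  also have "\<dots> = \<epsilon> * N1 / (\<beta>1 + \<mu>) * w + \<epsilon> * N1 / \<beta>1 * M"
    using E_pos [of \<alpha> \<beta>1 r] by (simp add: algebra_simps)
  finally have I1: "\<epsilon> * N1 / E \<alpha> \<beta>1 r * ?I1 \<le> \<epsilon> * N1 / (\<beta>1 + \<mu>) * w + \<epsilon> * N1 / \<beta>1 * M" .
  have "?I2 = integral {r..s} (\<lambda>\<tau>. \<bar>\<tau>\<bar> powr (\<alpha> - 1) * E \<alpha> (- \<beta>2) \<tau> * u \<tau>)"
    by (simp add: E_uminus)
  also have "\<dots> \<le> C * ((E \<alpha> (- \<beta>2 + \<mu>) s - E \<alpha> (- \<beta>2 + \<mu>) r) / (- \<beta>2 + \<mu>))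
      + M * ((E \<alpha> (- \<beta>2) s - E \<alpha> (- \<beta>2) r) / (- \<beta>2))"
    using pos \<mu> t0 r le cont' by (intro integral_weight_E_le) auto
  also have "\<dots> = C * ((E \<alpha> (- \<beta>2 + \<mu>) r - E \<alpha> (- \<beta>2 + \<mu>) s) / (\<beta>2 - \<mu>))
      + M * ((E \<alpha> (- \<beta>2) r - E \<alpha> (- \<beta>2) s) / \<beta>2)"
    using pos \<mu> by (simp add: field_simps)
  \<comment> \<open>Only the boundary term multiplied by \<open>M\<close> is dropped. The one
    multiplied by \<open>C\<close> is kept: it produces the factor \<open>1 - e\<close>, which makes
    room for the forcing term.\<close>
  also have "\<dots> \<le> C * ((E \<alpha> (- \<beta>2 + \<mu>) r - E \<alpha> (- \<beta>2 + \<mu>) s) / (\<beta>2 - \<mu>))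
      + M * (E \<alpha> (- \<beta>2) r / \<beta>2)"
    using C M pos \<mu> by (intro add_mono mult_left_mono divide_right_mono)
      (auto simp: less_imp_le [OF E_pos])
  finally have "\<epsilon> * N2 * E \<alpha> \<beta>2 r * ?I2 \<le> \<epsilon> * N2 * E \<alpha> \<beta>2 r *
      (C * ((E \<alpha> (- \<beta>2 + \<mu>) r - E \<alpha> (- \<beta>2 + \<mu>) s) / (\<beta>2 - \<mu>)) + M * (E \<alpha> (- \<beta>2) r / \<beta>2))"
    using pos by (intro mult_left_mono) (auto simp: less_imp_le [OF E_pos])
  also have "\<dots> = \<epsilon> * N2 / (\<beta>2 - \<mu>) * (C * E \<alpha> \<beta>2 r * (E \<alpha> (- \<beta>2 + \<mu>) r - E \<alpha> (- \<beta>2 + \<mu>) s))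
      + \<epsilon> * N2 / \<beta>2 * (M * (E \<alpha> \<beta>2 r * E \<alpha> (- \<beta>2) r))"
    by (simp add: distrib_left mult_ac)
  also have "C * E \<alpha> \<beta>2 r * (E \<alpha> (- \<beta>2 + \<mu>) r - E \<alpha> (- \<beta>2 + \<mu>) s) = w * (1 - e)"
  proof -
    have "E \<alpha> (- \<beta>2 + \<mu>) y = 1 / E \<alpha> (\<beta>2 - \<mu>) y" for y
      by (simp flip: E_uminus)
    then show ?thesis
      using E_pos [of \<alpha> "\<beta>2 - \<mu>" r] E_pos [of \<alpha> "\<beta>2 - \<mu>" s]
      by (simp add: w_def e_def E2 field_simps)
  qed
  also have "E \<alpha> \<beta>2 r * E \<alpha> (- \<beta>2) r = 1"
    using E_pos [of \<alpha> \<beta>2 r] by (simp add: E_uminus)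
  finally have I2: "\<epsilon> * N2 * E \<alpha> \<beta>2 r * ?I2
      \<le> \<epsilon> * N2 / (\<beta>2 - \<mu>) * (w * (1 - e)) + \<epsilon> * N2 / \<beta>2 * M"
    by simp
  define p where "p = \<epsilon> * N1 / (\<beta>1 + \<mu>)"
  define q where "q = \<epsilon> * N2 / (\<beta>2 - \<mu>)"
  \<comment> \<open>This serves the endpoint \<open>e = 1\<close>, where the forcing term
    contributes \<open>1 - \<theta>\<close>. The endpoint \<open>e = 0\<close> is the assumed
    inequality \<open>p + q \<le> 1\<close>.\<close>
  have "p \<le> \<epsilon> * N1 / \<beta>1"
    using pos \<mu> unfolding p_def by (intro divide_left_mono) auto
  also have "\<dots> \<le> \<theta>" using pos by (simp add: \<theta> algebra_simps)
  finally have p: "p \<le> \<theta>" .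
  \<comment> \<open>This is affine in \<open>e \<in> [0, 1]\<close>, so it suffices to bound it at the two endpoints.\<close>
  have "p + q * (1 - e) + (1 - \<theta>) * e = (1 - e) * (p + q) + e * (p + (1 - \<theta>))"
    by (simp add: algebra_simps)
  also have "\<dots> \<le> (1 - e) * 1 + e * 1"
    using p \<mu> e by (intro add_mono mult_left_mono) (auto simp: p_def q_def)
  finally have "w * (p + q * (1 - e) + (1 - \<theta>) * e) \<le> w * 1"
    using w by (intro mult_left_mono) auto
  moreover have "\<theta> * M < 1 * M" using \<theta>(2) M by (rule mult_strict_right_mono)
  moreover have "\<theta> * M = \<epsilon> * N1 / \<beta>1 * M + \<epsilon> * N2 / \<beta>2 * M"
    by (simp add: \<theta>(1) algebra_simps)
  \<comment> \<open>By the choice of \<open>M\<close>, \<open>u r\<close> equals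
    \<open>w + M\<close>. The facts above bound the right-hand side by
    \<open>w + \<theta> * M < w + M\<close>.\<close>
  moreover have "w + M \<le> (1 - \<theta>) * w * e + (p * w + \<epsilon> * N1 / \<beta>1 * M)
      + (q * (w * (1 - e)) + \<epsilon> * N2 / \<beta>2 * M)"
    using u [OF r] I1 I2 unfolding f p_def q_def M_def w_def by linarith
  ultimately show False by (simp add: algebra_simps)
qed

text \<open>The rate \<open>l\<close> solves
  \<open>\<epsilon> * N2 / (\<beta>2 - l) = 1 - \<theta>\<close>. If \<open>l \<ge> 0\<close>, the
  other coefficient \<open>\<epsilon> * N1 / (\<beta>1 + l)\<close> is at most
  \<open>\<theta>\<close>, so \<open>l\<close> is admissible as \<open>\<mu>\<close>.\<close>

lemma dichotomy_gronwall_nonneg: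
  fixes \<alpha> \<epsilon> N1 N2 \<beta>1 \<beta>2 \<theta> t0 s :: real
  assumes pos: "0 < \<alpha>" "0 < N1" "0 < N2" "0 < \<beta>1" "0 < \<beta>2" "0 < \<epsilon>"
    and \<theta>: "\<theta> = \<epsilon> * (N1 / \<beta>1 + N2 / \<beta>2)" "\<theta> < 1"
    and t0: "0 \<le> t0" "t0 \<le> s"
    and cont: "continuous_on {t0..s} u"
    and u: "\<And>t. t \<in> {t0..s} \<Longrightarrow> u t \<le> N2 * (E \<alpha> \<beta>2 t / E \<alpha> \<beta>2 s)
             + \<epsilon> * N1 / E \<alpha> \<beta>1 t
                 * integral {t0..t} (\<lambda>\<tau>. \<bar>\<tau>\<bar> powr (\<alpha> - 1) * E \<alpha> \<beta>1 \<tau> * u \<tau>)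
             + \<epsilon> * N2 * E \<alpha> \<beta>2 t
                 * integral {t..s} (\<lambda>\<tau>. \<bar>\<tau>\<bar> powr (\<alpha> - 1) * (u \<tau> / E \<alpha> \<beta>2 \<tau>))"
    and t: "t \<in> {t0..s}"
  defines "l \<equiv> \<beta>2 - \<epsilon> * N2 / (1 - \<theta>)"
  shows "u t \<le> N2 / (1 - \<theta>) * (E \<alpha> l t / E \<alpha> l s)"
proof (cases "0 \<le> l")
  case True
  have "\<epsilon> * N1 / (\<beta>1 + l) \<le> \<epsilon> * N1 / \<beta>1"
    using pos True by (intro divide_left_mono) auto
  also have "\<dots> \<le> \<theta>" using pos by (simp add: \<theta> algebra_simps)
  finally have "\<epsilon> * N1 / (\<beta>1 + l) + \<epsilon> * N2 / (\<beta>2 - l) \<le> 1"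
    using pos \<theta>(2) by (simp add: l_def)
  moreover have "l < \<beta>2" using pos \<theta>(2) by (simp add: l_def)
  ultimately show ?thesis
    by (intro le_supersolution [OF pos \<theta> True _ _ t0 cont u t])
next
  case False
  \<comment> \<open>For \<open>\<mu> = 0\<close> the sum is \<open>\<theta>\<close> itself. The
    resulting constant bound suffices because \<open>E \<alpha> l\<close> decreases for
    \<open>l < 0\<close>, so the quotient in the claim is at least 1.\<close>
  have "\<epsilon> * N1 / (\<beta>1 + 0) + \<epsilon> * N2 / (\<beta>2 - 0) \<le> 1"
    using \<theta> by (simp add: algebra_simps)
  then have "u t \<le> N2 / (1 - \<theta>) * (E \<alpha> 0 t / E \<alpha> 0 s)"
    by (intro le_supersolution [OF pos \<theta> order_refl pos(5) _ t0 cont u t])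
  also have "\<dots> \<le> N2 / (1 - \<theta>) * (E \<alpha> l t / E \<alpha> l s)"
  proof (rule mult_left_mono)
    have "E \<alpha> (- l) t \<le> E \<alpha> (- l) s"
      using pos t0 t False by (intro E_mono) auto
    then show "E \<alpha> 0 t / E \<alpha> 0 s \<le> E \<alpha> l t / E \<alpha> l s"
      using E_pos [of \<alpha> l t] E_pos [of \<alpha> l s] by (simp add: E_uminus E_def [of \<alpha> 0] field_simps)
  qed (use pos \<theta>(2) in auto)
  finally show ?thesis .
qed

theorem corollary3p1:
  fixes \<alpha> \<epsilon> N1 N2 \<beta>1 \<beta>2 \<theta> K1 K2 lam1 lam2 :: real
  assumes "0 < \<alpha>" and "\<alpha> \<le> 1"
    and "0 < N1" and "0 < N2" and "0 < \<beta>1" and "0 < \<beta>2" and "0 < \<epsilon>"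
    and "\<theta> = \<epsilon> * (N1 / \<beta>1 + N2 / \<beta>2)"
    and "K1 = N1 / (1 - \<theta>)" and "K2 = N2 / (1 - \<theta>)"
    and "lam1 = \<beta>1 - \<epsilon> * N1 / (1 - \<theta>)" and "lam2 = \<beta>2 - \<epsilon> * N2 / (1 - \<theta>)"
    and "\<theta> < 1"
  shows
    "(\<forall>(t0::real) (s::real) (u::real \<Rightarrow> real).
        0 \<le> t0 \<and> t0 \<le> s \<and>
        (\<forall>t\<in>{t0..s}. 0 \<le> u t) \<and> bounded (u ` {t0..s}) \<and> continuous_on {t0..s} u \<and>
        (\<forall>t\<in>{t0..s}.
           u t \<le> N2 * (E \<alpha> \<beta>2 t / E \<alpha> \<beta>2 s)
             + \<epsilon> * N1 / E \<alpha> \<beta>1 t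
                 * integral {t0..t} (\<lambda>\<tau>. \<bar>\<tau>\<bar> powr (\<alpha> - 1) * E \<alpha> \<beta>1 \<tau> * u \<tau>)
             + \<epsilon> * N2 * E \<alpha> \<beta>2 t
                 * integral {t..s} (\<lambda>\<tau>. \<bar>\<tau>\<bar> powr (\<alpha> - 1) * (u \<tau> / E \<alpha> \<beta>2 \<tau>)))
        \<longrightarrow> (\<forall>t\<in>{t0..s}. u t \<le> K2 * (E \<alpha> lam2 t / E \<alpha> lam2 s)))
     \<and>
     (\<forall>(t0::real) (s::real) (u::real \<Rightarrow> real).
        s \<le> t0 \<and> t0 \<le> 0 \<and>
        (\<forall>t\<in>{s..t0}. 0 \<le> u t) \<and> bounded (u ` {s..t0}) \<and> continuous_on {s..t0} u \<and>
        (\<forall>t\<in>{s..t0}.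
           u t \<le> N1 * (E \<alpha> \<beta>1 s / E \<alpha> \<beta>1 t)
             + \<epsilon> * N2 * E \<alpha> \<beta>2 t
                 * integral {t..t0} (\<lambda>\<tau>. \<bar>\<tau>\<bar> powr (\<alpha> - 1) * (u \<tau> / E \<alpha> \<beta>2 \<tau>))
             + \<epsilon> * N1 / E \<alpha> \<beta>1 t
                 * integral {s..t} (\<lambda>\<tau>. \<bar>\<tau>\<bar> powr (\<alpha> - 1) * E \<alpha> \<beta>1 \<tau> * u \<tau>))
        \<longrightarrow> (\<forall>t\<in>{s..t0}. u t \<le> K1 * (E \<alpha> lam1 s / E \<alpha> lam1 t)))"
proof (intro conjI allI impI; elim conjE)
  fix t0 s :: real and u :: "real \<Rightarrow> real"
  assume t0: "0 \<le> t0" "t0 \<le> s" and cont: "continuous_on {t0..s} u"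
    and u: "(\<forall>t\<in>{t0..s}.
           u t \<le> N2 * (E \<alpha> \<beta>2 t / E \<alpha> \<beta>2 s)
             + \<epsilon> * N1 / E \<alpha> \<beta>1 t
                 * integral {t0..t} (\<lambda>\<tau>. \<bar>\<tau>\<bar> powr (\<alpha> - 1) * E \<alpha> \<beta>1 \<tau> * u \<tau>)
             + \<epsilon> * N2 * E \<alpha> \<beta>2 t
                 * integral {t..s} (\<lambda>\<tau>. \<bar>\<tau>\<bar> powr (\<alpha> - 1) * (u \<tau> / E \<alpha> \<beta>2 \<tau>)))"
  show "\<forall>t\<in>{t0..s}. u t \<le> K2 * (E \<alpha> lam2 t / E \<alpha> lam2 s)"
    unfolding assms(10,12) using u
    by (intro ballI dichotomy_gronwall_nonneg [where u = u, OF assms(1,3-8,13) t0 cont]) blast+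
next
  fix t0 s :: real and u :: "real \<Rightarrow> real"
  assume t0: "s \<le> t0" "t0 \<le> 0" and cont: "continuous_on {s..t0} u"
    and u: "(\<forall>t\<in>{s..t0}.
           u t \<le> N1 * (E \<alpha> \<beta>1 s / E \<alpha> \<beta>1 t)
             + \<epsilon> * N2 * E \<alpha> \<beta>2 t
                 * integral {t..t0} (\<lambda>\<tau>. \<bar>\<tau>\<bar> powr (\<alpha> - 1) * (u \<tau> / E \<alpha> \<beta>2 \<tau>))
             + \<epsilon> * N1 / E \<alpha> \<beta>1 t
                 * integral {s..t} (\<lambda>\<tau>. \<bar>\<tau>\<bar> powr (\<alpha> - 1) * E \<alpha> \<beta>1 \<tau> * u \<tau>))"
  show "\<forall>t\<in>{s..t0}. u t \<le> K1 * (E \<alpha> lam1 s / E \<alpha> lam1 t)"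
  proof
    fix t assume t: "t \<in> {s..t0}"
    \<comment> \<open>The double negation presents \<open>u t\<close> as the reflected function
      evaluated at \<open>- t\<close>.\<close>
    have "u (- (- t)) \<le> N1 / (1 - \<theta>) * (E \<alpha> lam1 (- t) / E \<alpha> lam1 (- s))"
      unfolding assms(11)
    proof (rule dichotomy_gronwall_nonneg [of \<alpha> N2 N1 \<beta>2 \<beta>1 \<epsilon> \<theta> "- t0" "- s" "\<lambda>x. u (- x)" "- t"])
      show "continuous_on {- t0..- s} (\<lambda>x. u (- x))"
        by (rule continuous_on_compose2 [OF cont]) (auto intro: continuous_intros)
      show "\<theta> = \<epsilon> * (N2 / \<beta>2 + N1 / \<beta>1)"
        using assms(8) by simp
      fix x assume x: "x \<in> {- t0..- s}"
      \<comment> \<open>The factor \<open>\<bar>\<tau>\<bar> powr (\<alpha> - 1)\<close> is even and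
        \<open>E\<close> passes to its reciprocal, so the integral over later times becomes one over
        earlier times with the kernel of the other kind.\<close>
      have "integral {- t0..x} (\<lambda>\<tau>. \<bar>\<tau>\<bar> powr (\<alpha> - 1) * E \<alpha> \<beta>2 \<tau> * u (- \<tau>))
          = integral {- x..t0} (\<lambda>\<tau>. \<bar>\<tau>\<bar> powr (\<alpha> - 1) * (u \<tau> / E \<alpha> \<beta>2 \<tau>))"
        using Henstock_Kurzweil_Integration.integral_reflect_real [where a = "- x" and b = t0
            and f = "\<lambda>\<tau>. \<bar>\<tau>\<bar> powr (\<alpha> - 1) * (u \<tau> / E \<alpha> \<beta>2 \<tau>)"]
        by (simp add: E_minus mult_ac)
      moreover have "integral {x..- s} (\<lambda>\<tau>. \<bar>\<tau>\<bar> powr (\<alpha> - 1) * (u (- \<tau>) / E \<alpha> \<beta>1 \<tau>))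
          = integral {s..- x} (\<lambda>\<tau>. \<bar>\<tau>\<bar> powr (\<alpha> - 1) * E \<alpha> \<beta>1 \<tau> * u \<tau>)"
        using Henstock_Kurzweil_Integration.integral_reflect_real [where a = s and b = "- x"
            and f = "\<lambda>\<tau>. \<bar>\<tau>\<bar> powr (\<alpha> - 1) * E \<alpha> \<beta>1 \<tau> * u \<tau>"]
        by (simp add: E_minus mult_ac)
      moreover have "- x \<in> {s..t0}" using x by auto
      ultimately show "u (- x) \<le> N1 * (E \<alpha> \<beta>1 x / E \<alpha> \<beta>1 (- s))
               + \<epsilon> * N2 / E \<alpha> \<beta>2 x
                   * integral {- t0..x} (\<lambda>\<tau>. \<bar>\<tau>\<bar> powr (\<alpha> - 1) * E \<alpha> \<beta>2 \<tau> * u (- \<tau>))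
               + \<epsilon> * N1 * E \<alpha> \<beta>1 x
                   * integral {x..- s} (\<lambda>\<tau>. \<bar>\<tau>\<bar> powr (\<alpha> - 1) * (u (- \<tau>) / E \<alpha> \<beta>1 \<tau>))"
        using bspec [OF u, of "- x"] by (simp add: E_minus mult_ac)
    qed (use t0 t assms(1-7,13) in auto)
    then show "u t \<le> K1 * (E \<alpha> lam1 s / E \<alpha> lam1 t)"
      by (simp add: E_minus assms(9))
  qed
qed

end
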